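(* Let $\mathbb{X}$ be a reflexive Opial space and let $\mathcal{M}\subset\mathbb{X}$ be a non-empty, bounded, norm closed and convex subset with diameter $d_{\mathcal{M}}>0$. Let $f:\mathcal{M}\to\mathcal{M}$ be a self-map which is weakly sequentially non-expansive on $\mathcal{M}$ and which satisfies the property $(\flat)$. Then $f$ has a fixed point, i.e. there exists $x\in\mathcal{M}$ with $f(x)=x$.
   Context: All Banach spaces are real; the norm is denoted by $\|\cdot\|$, and $\rightharpoonup$ denotes weak convergence. Opial space: a Banach space $\mathbb{X}$ such that for every weakly convergent sequence $x_n\rightharpoonup x_\infty$ in $\mathbb{X}$ one has $\liminf_{n\to\infty}\|x_n-x_\infty\|<\liminf_{n\to\infty}\|x_n-z\|$ for all $z\in\mathbb{X}$ with $z\neq x_\infty$. Diameter: $d_{\mathcal{M}}:=\sup_{v,w\in\mathcal{M}}\|v-w\|$. Weak sequential non-expansiveness: a mapping $f:\mathcal{M}\to\mathbb{X}$ is weakly sequentially non-expansive at $y\in\mathcal{M}$ if for any sequence $\{y_n\}_n\subset\mathcal{M}$ with $y_n\rightharpoonup y$ it holds that $\liminf_{n\to\infty}\|f(y_n)-f(y)\|\le\liminf_{n\to\infty}\|y_n-y\|$. It is weakly sequentially non-expansive on $\mathcal{M}$ if this holds at every $y\in\mathcal{M}$. Property $(\flat)$ for a mapping $f:\mathcal{M}\to\mathbb{X}$: there is a constant $\delta\in(0,1)$ (depending on $f$) such that, whenever a sequence $\{y_n\}_n\subset\mathcal{M}$ satisfies $$0<\limsup_{n\to\infty}\|y_{n+1}-y_n\|<\limsup_{n\to\infty}\|f(y_{n+1})-f(y_n)\|,$$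 then $$\limsup_{n\to\infty}\|y_{n+1}-f(y_n)\|>\delta\, d_{\mathcal{M}}.$$ *)

theory Defs
  imports "HOL-Analysis.Analysis"
begin

(* Limits inferior and superior of real sequences are taken in ereal, so they always exist
   and no boundedness has to be assumed. The dual space is the type of bounded linear
   functionals 'a \<Rightarrow>\<^sub>L real. *)

definition weakly_converges :: "(nat \<Rightarrow> 'a::real_normed_vector) \<Rightarrow> 'a \<Rightarrow> bool" where
  "weakly_converges x l \<longleftrightarrow>
     (\<forall>\<phi> :: 'a \<Rightarrow>\<^sub>L real. (\<lambda>n. blinfun_apply \<phi> (x n)) \<longlonglongrightarrow> blinfun_apply \<phi> l)"

(* Surjectivity of the canonical embedding of the space into its bidual. *)
definition reflexive_space :: "'a::real_normed_vector itself \<Rightarrow> bool" where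
  "reflexive_space _ \<longleftrightarrow>
     (\<forall>\<Phi> :: ('a \<Rightarrow>\<^sub>L real) \<Rightarrow>\<^sub>L real. \<exists>x :: 'a. \<forall>\<phi>. blinfun_apply \<Phi> \<phi> = blinfun_apply \<phi> x)"

definition opial_space :: "'a::real_normed_vector itself \<Rightarrow> bool" where
  "opial_space _ \<longleftrightarrow>
     (\<forall>(x :: nat \<Rightarrow> 'a) l. weakly_converges x l \<longrightarrow>
        (\<forall>z. z \<noteq> l \<longrightarrow>
           liminf (\<lambda>n. ereal (norm (x n - l))) < liminf (\<lambda>n. ereal (norm (x n - z)))))"

definition weakly_seq_nonexpansive_at ::
    "'a::real_normed_vector set \<Rightarrow> ('a \<Rightarrow> 'a) \<Rightarrow> 'a \<Rightarrow> bool" where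
  "weakly_seq_nonexpansive_at M f y \<longleftrightarrow>
     (\<forall>u :: nat \<Rightarrow> 'a. (\<forall>n. u n \<in> M) \<longrightarrow> weakly_converges u y \<longrightarrow>
        liminf (\<lambda>n. ereal (norm (f (u n) - f y))) \<le> liminf (\<lambda>n. ereal (norm (u n - y))))"

definition weakly_seq_nonexpansive_on ::
    "'a::real_normed_vector set \<Rightarrow> ('a \<Rightarrow> 'a) \<Rightarrow> bool" where
  "weakly_seq_nonexpansive_on M f \<longleftrightarrow> (\<forall>y\<in>M. weakly_seq_nonexpansive_at M f y)"

definition property_flat :: "'a::real_normed_vector set \<Rightarrow> ('a \<Rightarrow> 'a) \<Rightarrow> bool" where
  "property_flat M f \<longleftrightarrow>
     (\<exists>\<delta>::real. 0 < \<delta> \<and> \<delta> < 1 \<and>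
        (\<forall>u :: nat \<Rightarrow> 'a. (\<forall>n. u n \<in> M) \<longrightarrow>
           0 < limsup (\<lambda>n. ereal (norm (u (Suc n) - u n))) \<longrightarrow>
           limsup (\<lambda>n. ereal (norm (u (Suc n) - u n)))
             < limsup (\<lambda>n. ereal (norm (f (u (Suc n)) - f (u n)))) \<longrightarrow>
           limsup (\<lambda>n. ereal (norm (u (Suc n) - f (u n)))) > ereal (\<delta> * diameter M)))"

end

theory Submission
  imports Defs
begin

text \<open>
  A weak limit \<open>x\<close> of an approximate fixed point sequence \<open>v\<close> is a fixed point: since
  \<open>f (v n) - v n\<close> is a null sequence, weak sequential non-expansiveness gives
  \<open>liminf \<parallel>v n - f x\<parallel> \<le> liminf \<parallel>v n - x\<parallel>\<close>, and in an Opial space this forces \<open>f x = x\<close>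
  (\<open>opial_demiclosed\<close>). So three things are needed: an approximate fixed point sequence in \<open>M\<close>,
  a weakly convergent subsequence of it, and membership of the weak limit in \<open>M\<close>.

  The sequence comes from the averaged iteration
  \<open>u (n + 1) = \<delta> u n + (1 - \<delta>) f (u n)\<close>, where \<open>\<delta>\<close> is the constant of property \<open>\<flat>\<close>. Its distance
  \<open>\<parallel>u (n + 1) - f (u n)\<parallel> = \<delta> \<parallel>u n - f (u n)\<parallel>\<close> never exceeds \<open>\<delta>\<close> times the diameter, so the
  conclusion of property \<open>\<flat>\<close> fails for it, and therefore one of the two premises fails. Either
  \<open>u (n + 1) - u n\<close> tends to 0, and then so does its multiple \<open>f (u n) - u n\<close>, or
  \<open>limsup \<parallel>f (u (n + 1)) - f (u n)\<parallel> \<le> limsup \<parallel>u (n + 1) - u n\<parallel>\<close>. In the second case an argument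
  in the style of Ishikawa and of Goebel and Kirk applies
  (\<open>averaged_iteration_asymptotically_regular\<close>): if \<open>\<parallel>f (u n) - u n\<parallel>\<close> had limsup \<open>r > 0\<close>, then
  \<open>\<parallel>f (u (n + i)) - u n\<parallel>\<close> would come arbitrarily close to \<open>(1 + i (1 - \<delta>)) r\<close> for every \<open>i\<close>,
  which is impossible in a bounded set.

  For the subsequence (\<open>reflexive_weakly_convergent_subsequence\<close>), the Hahn-Banach theorem is applied
  on the dual space to a limsup functional. By reflexivity this yields, for every bounded sequence,
  a point at which each functional lies between the liminf and the limsup of its values along the
  sequence. A diagonal
  argument over countably many functionals that separate the points of the closed span makes this
  point the same for all further subsequences, and then it is a weak limit.
  The Hahn-Banach theorem also puts weak limits back into closed convex sets; it is obtained, together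
  with a form of the Mazur-Orlicz theorem, from the fact that minimal sublinear functionals are linear.
\<close>

section \<open>Sublinear functionals and the Hahn-Banach theorem\<close>

definition sublinear :: "('a::real_vector \<Rightarrow> real) \<Rightarrow> bool" where
  "sublinear p \<longleftrightarrow> (\<forall>x y. p (x + y) \<le> p x + p y) \<and> (\<forall>t\<ge>0. \<forall>x. p (t *\<^sub>R x) = t * p x)"

lemma sublinear_add: "sublinear p \<Longrightarrow> p (x + y) \<le> p x + p y"
  by (simp add: sublinear_def)

lemma sublinear_scale: "sublinear p \<Longrightarrow> t \<ge> 0 \<Longrightarrow> p (t *\<^sub>R x) = t * p x"
  by (simp add: sublinear_def)

lemma sublinear_zero: "sublinear p \<Longrightarrow> p 0 = 0"
  using sublinear_scale[of p 0 0] by simp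

lemma sublinear_neg_le: "sublinear p \<Longrightarrow> - p (- x) \<le> p x"
  using sublinear_add[of p x "- x"] sublinear_zero[of p] by simp

lemma sublinearI:
  assumes add: "\<And>x y. p (x + y) \<le> p x + p y"
    and scale: "\<And>t x. t > 0 \<Longrightarrow> p (t *\<^sub>R x) \<le> t * p x"
  shows "sublinear p"
proof -
  have zero: "p 0 = 0"
    using scale[of 2 0] scale[of "1/2" 0] by simp
  have "p (t *\<^sub>R x) = t * p x" if "t \<ge> 0" for t x
  proof (cases "t = 0")
    case False
    with that have t: "t > 0" by simp
    have "p x \<le> inverse t * p (t *\<^sub>R x)"
      using scale[of "inverse t" "t *\<^sub>R x"] t by simp
    then have "t * p x \<le> p (t *\<^sub>R x)"
      using t by (simp add: field_simps)
    with scale[OF t, of x] show ?thesis by simp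
  qed (simp add: zero)
  with add show ?thesis by (auto simp: sublinear_def)
qed

text \<open>
  The functional \<open>q v = inf {p (v + t c) - t \<beta> | t \<ge> 0, c \<in> C}\<close> is sublinear because the points
  \<open>(t, t c)\<close> form a convex cone, and it is finite because \<open>p (v + t c) - t \<beta> \<ge> - p (- v)\<close>.
  A linear functional below \<open>q\<close> is below \<open>p\<close> and at least \<open>\<beta>\<close> on \<open>C\<close>, as in the Mazur-Orlicz
  theorem. The case of a singleton \<open>C\<close> is also what makes minimal sublinear functionals linear.
\<close>

lemma sublinear_shrink:
  fixes p :: "'a::real_vector \<Rightarrow> real"
  assumes p: "sublinear p" and C: "convex C" "C \<noteq> {}" and \<beta>: "\<And>c. c \<in> C \<Longrightarrow> \<beta> \<le> p c"
  obtains q where "sublinear q" "\<And>v. q v \<le> p v" "\<And>c. c \<in> C \<Longrightarrow> q (- c) \<le> - \<beta>"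
proof -
  define g where "g v = (\<lambda>(t, c). p (v + t *\<^sub>R c) - t * \<beta>)" for v
  define I where "I = {0::real..} \<times> C"
  define q where "q v = (INF i\<in>I. g v i)" for v
  have ne: "I \<noteq> {}" using C by (auto simp: I_def)
  have "- p (- v) \<le> g v i" if "i \<in> I" for v i
  proof -
    obtain t c where i: "i = (t, c)" "t \<ge> 0" "c \<in> C" using \<open>i \<in> I\<close> by (auto simp: I_def)
    have "t * \<beta> \<le> t * p c" using i \<beta> by (simp add: mult_left_mono)
    also have "\<dots> = p ((v + t *\<^sub>R c) + - v)" using i by (simp add: sublinear_scale[OF p])
    also have "\<dots> \<le> p (v + t *\<^sub>R c) + p (- v)" by (rule sublinear_add[OF p])
    finally show ?thesis by (simp add: g_def i)
  qed
  then have bdd: "bdd_below (g v ` I)" for v by (auto intro!: bdd_belowI2)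
  have lower: "q v \<le> p (v + t *\<^sub>R c) - t * \<beta>" if "t \<ge> 0" "c \<in> C" for v t c
    using cINF_lower[OF bdd, of "(t, c)" v] that by (simp add: q_def g_def I_def)
  have "sublinear q"
  proof (rule sublinearI)
    fix x y
    have 1: "q (x + y) \<le> g x i + g y j" if IJ: "i \<in> I" "j \<in> I" for i j
    proof -
      obtain s b t c where ij: "i = (s, b)" "j = (t, c)" "s \<ge> 0" "t \<ge> 0" "b \<in> C" "c \<in> C"
        using IJ unfolding I_def by blast
      \<comment> \<open>The cone over \<open>C\<close> is closed under addition; the apex \<open>s = t = 0\<close> needs some point of \<open>C\<close>.\<close>
      obtain e where e: "e \<in> C" "(s + t) *\<^sub>R e = s *\<^sub>R b + t *\<^sub>R c"
      proof (cases "s + t = 0")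
        case True
        with ij have "s = 0" "t = 0" by auto
        with ij that show ?thesis by auto
      next
        case False
        have "(s / (s + t)) *\<^sub>R b + (t / (s + t)) *\<^sub>R c \<in> C"
          using ij False by (intro convexD[OF C(1)]) (auto simp: add_divide_distrib[symmetric])
        moreover have "(s + t) *\<^sub>R ((s / (s + t)) *\<^sub>R b + (t / (s + t)) *\<^sub>R c) = s *\<^sub>R b + t *\<^sub>R c"
          using False by (simp add: scaleR_add_right)
        ultimately show ?thesis using that by blast
      qed
      have "q (x + y) \<le> p ((x + y) + (s + t) *\<^sub>R e) - (s + t) * \<beta>"
        using ij e by (intro lower) auto
      also have "(x + y) + (s + t) *\<^sub>R e = (x + s *\<^sub>R b) + (y + t *\<^sub>R c)"
        using e(2) by (simp add: algebra_simps)
      also have "p \<dots> - (s + t) * \<beta> \<le> g x i + g y j"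
        using sublinear_add[OF p, of "x + s *\<^sub>R b" "y + t *\<^sub>R c"] by (simp add: g_def ij algebra_simps)
      finally show ?thesis .
    qed
    have "q (x + y) - g x i \<le> g y j" if "i \<in> I" "j \<in> I" for i j
      using 1[OF that] by simp
    then have 2: "q (x + y) - g x i \<le> q y" if "i \<in> I" for i
      unfolding q_def[of y] using that by (intro cINF_greatest ne)
    have "q (x + y) - q y \<le> g x i" if "i \<in> I" for i
      using 2[OF that] by simp
    then have "q (x + y) - q y \<le> q x"
      unfolding q_def[of x] by (intro cINF_greatest ne)
    then show "q (x + y) \<le> q x + q y" by simp
  next
    fix s :: real and x assume s: "s > 0"
    have "q (s *\<^sub>R x) / s \<le> g x i" if "i \<in> I" for i
    proof -
      obtain t c where i: "i = (t, c)" "t \<ge> 0" "c \<in> C" using \<open>i \<in> I\<close> by (auto simp: I_def)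
      have "q (s *\<^sub>R x) \<le> p (s *\<^sub>R x + (s * t) *\<^sub>R c) - (s * t) * \<beta>"
        using i s by (intro lower) auto
      also have "s *\<^sub>R x + (s * t) *\<^sub>R c = s *\<^sub>R (x + t *\<^sub>R c)" by (simp add: scaleR_add_right)
      also have "p \<dots> - (s * t) * \<beta> = s * g x i"
        using s by (simp add: sublinear_scale[OF p] g_def i right_diff_distrib)
      finally show ?thesis using s by (simp add: field_simps)
    qed
    then have "q (s *\<^sub>R x) / s \<le> q x"
      unfolding q_def[of x] by (intro cINF_greatest ne)
    then show "q (s *\<^sub>R x) \<le> s * q x" using s by (simp add: field_simps)
  qed
  moreover have "q v \<le> p v" for v
    using C lower[of 0 _ v] by auto
  moreover have "q (- c) \<le> - \<beta>" if "c \<in> C" for c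
    using lower[of 1 c "- c"] that by (simp add: sublinear_zero[OF p])
  ultimately show ?thesis using that by blast
qed

text \<open>
  Infima of chains are what Zorn's lemma requires. The chain condition enters in subadditivity, where
  the values \<open>q x\<close> and \<open>r y\<close> of two members have to be compared with those of a single one.
\<close>

lemma sublinear_INF_chain:
  fixes p :: "'a::real_vector \<Rightarrow> real"
  assumes ne: "C \<noteq> {}" and sub: "\<And>q. q \<in> C \<Longrightarrow> sublinear q \<and> q \<le> p"
    and chain: "\<And>q r. q \<in> C \<Longrightarrow> r \<in> C \<Longrightarrow> q \<le> r \<or> r \<le> q"
  obtains h where "sublinear h" "\<And>q. q \<in> C \<Longrightarrow> h \<le> q"
proof -
  define h where "h v = (INF q\<in>C. q v)" for v
  have "- p (- v) \<le> q v" if "q \<in> C" for q v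
  proof -
    have "q (- v) \<le> p (- v)" using sub[OF that] by (simp add: le_fun_def)
    then show ?thesis using sublinear_neg_le[of q v] sub[OF that] by simp
  qed
  then have bdd: "bdd_below ((\<lambda>q. q v) ` C)" for v by (auto intro!: bdd_belowI2)
  have lower: "h v \<le> q v" if "q \<in> C" for q v
    unfolding h_def by (rule cINF_lower[OF bdd that])
  have "sublinear h"
  proof (rule sublinearI)
    fix x y
    have 1: "h (x + y) \<le> q x + r y" if qr: "q \<in> C" "r \<in> C" for q r
    proof -
      obtain s where s: "s \<in> C" "s \<le> q" "s \<le> r" using chain[OF qr] qr by blast
      have "h (x + y) \<le> s (x + y)" by (rule lower) fact
      also have "\<dots> \<le> s x + s y" using sub s sublinear_add by blast
      also have "\<dots> \<le> q x + r y" using s by (auto simp: le_fun_def intro: add_mono)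
      finally show ?thesis .
    qed
    have "h (x + y) - q x \<le> r y" if "q \<in> C" "r \<in> C" for q r
      using 1[OF that] by simp
    then have 2: "h (x + y) - q x \<le> h y" if "q \<in> C" for q
      unfolding h_def[of y] using that by (intro cINF_greatest ne)
    have "h (x + y) - h y \<le> q x" if "q \<in> C" for q
      using 2[OF that] by simp
    then have "h (x + y) - h y \<le> h x"
      unfolding h_def[of x] by (intro cINF_greatest ne)
    then show "h (x + y) \<le> h x + h y" by simp
  next
    fix t :: real and x assume t: "t > 0"
    have "h (t *\<^sub>R x) / t \<le> q x" if "q \<in> C" for q
      using lower[OF that, of "t *\<^sub>R x"] sub[OF that] t by (simp add: sublinear_scale field_simps)
    then have "h (t *\<^sub>R x) / t \<le> h x"
      unfolding h_def[of x] by (intro cINF_greatest ne)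
    then show "h (t *\<^sub>R x) \<le> t * h x" using t by (simp add: field_simps)
  qed
  with lower that show ?thesis by (simp add: le_fun_def)
qed

text \<open>
  The Hahn-Banach theorem. By Zorn's lemma there is a minimal sublinear functional \<open>m\<close> below \<open>p\<close>.
  Shrinking \<open>m\<close> along \<open>{y}\<close> with the value \<open>m y\<close> cannot change it, so \<open>m (- y) \<le> - m y\<close>;
  an odd sublinear functional is linear. No extension of partially defined functionals occurs.
\<close>

theorem linear_below_sublinear:
  fixes p :: "'a::real_vector \<Rightarrow> real"
  assumes p: "sublinear p"
  obtains L where "linear L" "\<And>v. L v \<le> p v"
proof -
  define S where "S = {q. sublinear q \<and> q \<le> p}"
  have "\<exists>m\<in>S. \<forall>a\<in>S. a \<le> m \<longrightarrow> a = m"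
  proof (rule predicate_Zorn)
    show "partial_order_on S (relation_of (\<lambda>q r. r \<le> q) S)"
      by (rule partial_order_on_relation_ofI) auto
    fix C assume "C \<in> Chains (relation_of (\<lambda>q r. r \<le> q) S)"
    then have C: "C \<subseteq> S" "\<And>q r. q \<in> C \<Longrightarrow> r \<in> C \<Longrightarrow> q \<le> r \<or> r \<le> q"
      by (auto simp: Chains_def relation_of_def)
    show "\<exists>u\<in>S. \<forall>a\<in>C. u \<le> a"
    proof (cases "C = {}")
      case True
      with p show ?thesis by (auto simp: S_def)
    next
      case False
      then obtain h where "sublinear h" "\<And>q. q \<in> C \<Longrightarrow> h \<le> q"
        using sublinear_INF_chain[of C p] C unfolding S_def by blast
      moreover obtain r where "r \<in> C" using False by blast
      ultimately have "h \<in> S" using C unfolding S_def by (blast intro: order_trans)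
      with \<open>\<And>q. q \<in> C \<Longrightarrow> h \<le> q\<close> show ?thesis by blast
    qed
  qed
  then obtain m where "m \<in> S" and min': "\<And>a. a \<in> S \<Longrightarrow> a \<le> m \<Longrightarrow> a = m"
    by blast
  then have m: "sublinear m" "m \<le> p" by (auto simp: S_def)
  have min: "a = m" if "sublinear a" "a \<le> m" for a
    using that m order_trans[of a m p] by (intro min') (simp_all add: S_def)
  have odd: "m (- y) = - m y" for y
  proof -
    obtain q where q: "sublinear q" "\<And>v. q v \<le> m v" "q (- y) \<le> - m y"
      using sublinear_shrink[OF m(1), of "{y}" "m y"] by auto
    with min have "q = m" by (auto simp: le_fun_def)
    with q show ?thesis using sublinear_neg_le[OF m(1), of "- y"] by simp
  qed
  have "linear m"
  proof (rule linearI)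
    fix x y
    have "m (- x + - y) \<le> m (- x) + m (- y)" by (rule sublinear_add[OF m(1)])
    then have "m x + m y \<le> m (x + y)" using odd[of "x + y"] by (simp add: odd)
    with sublinear_add[OF m(1), of x y] show "m (x + y) = m x + m y" by simp
  next
    fix t x
    show "m (t *\<^sub>R x) = t *\<^sub>R m x"
    proof (cases "t \<ge> 0")
      case False
      then have "m (t *\<^sub>R x) = - ((- t) * m x)"
        using odd[of "(- t) *\<^sub>R x"] sublinear_scale[OF m(1), of "- t" x] by simp
      then show ?thesis by simp
    qed (simp add: sublinear_scale[OF m(1)])
  qed
  with m that show ?thesis by (auto simp: le_fun_def)
qed

lemma blinfun_below_sublinear:
  fixes p :: "'a::real_normed_vector \<Rightarrow> real"
  assumes p: "sublinear p" and B: "\<And>v. p v \<le> B * norm v"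
  obtains \<phi> :: "'a \<Rightarrow>\<^sub>L real" where "\<And>v. \<phi> v \<le> p v"
proof -
  obtain L where L: "linear L" "\<And>v. L v \<le> p v" using linear_below_sublinear[OF p] by blast
  have "bounded_linear L"
  proof (rule bounded_linear_intro[where K = B])
    fix x
    have "L x \<le> B * norm x" "L (- x) \<le> B * norm x"
      using L(2)[of x] B[of x] L(2)[of "- x"] B[of "- x"] by simp_all
    then show "norm (L x) \<le> norm x * B"
      using L(1) by (simp add: linear_neg abs_le_iff mult.commute)
  qed (use L in \<open>auto simp: linear_add linear_scale\<close>)
  with L that[of "Blinfun L"] show ?thesis by (simp add: bounded_linear_Blinfun_apply)
qed

text \<open>
  The Mazur-Orlicz theorem for the norm. With \<open>C = {d}\<close> it gives norming functionals, with \<open>C\<close> a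
  translate of a closed convex set it gives separation from a point.
\<close>

lemma functional_above_on_convex:
  fixes C :: "'a::real_normed_vector set"
  assumes "convex C" "C \<noteq> {}" "\<And>c. c \<in> C \<Longrightarrow> \<beta> \<le> norm c"
  shows "\<exists>\<phi> :: 'a \<Rightarrow>\<^sub>L real. (\<forall>v. \<bar>\<phi> v\<bar> \<le> norm v) \<and> (\<forall>c\<in>C. \<beta> \<le> \<phi> c)"
proof -
  have "sublinear (norm :: 'a \<Rightarrow> real)" by (simp add: sublinear_def norm_triangle_ineq)
  then obtain q :: "'a \<Rightarrow> real" where q: "sublinear q" "\<And>v. q v \<le> norm v"
      "\<And>c. c \<in> C \<Longrightarrow> q (- c) \<le> - \<beta>"
    using sublinear_shrink[of norm C \<beta>] assms by blast
  obtain \<phi> :: "'a \<Rightarrow>\<^sub>L real" where \<phi>: "\<And>v. \<phi> v \<le> q v"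
    using blinfun_below_sublinear[of q 1] q by auto
  have le: "\<phi> v \<le> norm v" for v using \<phi>[of v] q(2)[of v] by simp
  have "\<bar>\<phi> v\<bar> \<le> norm v" for v
    using le[of v] le[of "- v"] by (simp add: blinfun.minus_right)
  moreover have "\<beta> \<le> \<phi> c" if "c \<in> C" for c
    using \<phi>[of "- c"] q(3)[OF that] by (simp add: blinfun.minus_right)
  ultimately show ?thesis by blast
qed

lemma functional_separates_closed_convex:
  fixes C :: "'a::real_normed_vector set"
  assumes "convex C" "C \<noteq> {}" "closed C" "x \<notin> C"
  obtains \<phi> :: "'a \<Rightarrow>\<^sub>L real" and d where "d > 0" "\<And>c. c \<in> C \<Longrightarrow> \<phi> x + d \<le> \<phi> c"
proof -
  have "open (- C)" "x \<in> - C" using assms by auto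
  then obtain d where "d > 0" "ball x d \<subseteq> - C"
    using open_contains_ball by blast
  then have d: "d > 0" "\<And>c. c \<in> C \<Longrightarrow> d \<le> dist x c"
    by (auto simp: subset_iff not_less[symmetric])
  have "convex ((\<lambda>c. c - x) ` C)"
    using assms(1) by (rule convex_translation_subtract)
  moreover have "(\<lambda>c. c - x) ` C \<noteq> {}"
    using assms(2) by simp
  moreover have "d \<le> norm c" if "c \<in> (\<lambda>c. c - x) ` C" for c
    using that d by (auto simp: dist_norm norm_minus_commute)
  ultimately have "\<exists>\<phi> :: 'a \<Rightarrow>\<^sub>L real. (\<forall>v. \<bar>\<phi> v\<bar> \<le> norm v) \<and> (\<forall>c\<in>(\<lambda>c. c - x) ` C. d \<le> \<phi> c)"
    by (rule functional_above_on_convex)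
  then obtain \<phi> :: "'a \<Rightarrow>\<^sub>L real" where "\<And>c. c \<in> C \<Longrightarrow> d \<le> \<phi> (c - x)"
    by blast
  then have "\<phi> x + d \<le> \<phi> c" if "c \<in> C" for c
    using that by (fastforce simp: blinfun.diff_right)
  with d that show ?thesis by blast
qed

section \<open>Weak sequential compactness in reflexive spaces\<close>

text \<open>
  Equivalently, every functional takes at \<open>x\<close> a value between the liminf and the limsup of its values
  along \<open>u\<close>; the lower bound follows by passing to \<open>- \<phi>\<close>. Such a point need not be unique, unlike a
  weak limit, but in a reflexive space every bounded sequence has one without passing to a subsequence.
\<close>

definition generalized_weak_limit :: "(nat \<Rightarrow> 'a::real_normed_vector) \<Rightarrow> 'a \<Rightarrow> bool" where
  "generalized_weak_limit u x \<longleftrightarrow>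
     (\<forall>(\<phi> :: 'a \<Rightarrow>\<^sub>L real) c. (\<forall>\<^sub>F n in sequentially. \<phi> (u n) \<le> c) \<longrightarrow> \<phi> x \<le> c)"

lemma generalized_weak_limit_le:
  fixes \<phi> :: "'a::real_normed_vector \<Rightarrow>\<^sub>L real"
  assumes "generalized_weak_limit u x" "\<forall>\<^sub>F n in sequentially. \<phi> (u n) \<le> c"
  shows "\<phi> x \<le> c"
  using assms by (auto simp: generalized_weak_limit_def)

lemma generalized_weak_limit_ge:
  fixes \<phi> :: "'a::real_normed_vector \<Rightarrow>\<^sub>L real"
  assumes "generalized_weak_limit u x" "\<forall>\<^sub>F n in sequentially. c \<le> \<phi> (u n)"
  shows "c \<le> \<phi> x"
  using generalized_weak_limit_le[OF assms(1), of "- \<phi>" "- c"] assms(2)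
  by (simp add: blinfun.minus_left)

lemma generalized_weak_limit_eq:
  fixes \<phi> :: "'a::real_normed_vector \<Rightarrow>\<^sub>L real"
  assumes "generalized_weak_limit u x" "(\<lambda>n. \<phi> (u n)) \<longlonglongrightarrow> l"
  shows "\<phi> x = l"
proof (rule antisym)
  show "\<phi> x \<le> l"
  proof (rule field_le_epsilon)
    fix e :: real assume "e > 0"
    then have "\<forall>\<^sub>F n in sequentially. \<phi> (u n) < l + e"
      using assms(2) by (intro order_tendstoD) auto
    then show "\<phi> x \<le> l + e"
      by (intro generalized_weak_limit_le[OF assms(1)]) (auto elim: eventually_mono)
  qed
  show "l \<le> \<phi> x"
  proof (rule field_le_epsilon)
    fix e :: real assume "e > 0"
    then have "\<forall>\<^sub>F n in sequentially. l - e < \<phi> (u n)"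
      using assms(2) by (intro order_tendstoD) auto
    then have "l - e \<le> \<phi> x"
      by (intro generalized_weak_limit_ge[OF assms(1)]) (auto elim: eventually_mono)
    then show "l \<le> \<phi> x + e" by simp
  qed
qed

lemma generalized_weak_limit_in_closed_convex:
  assumes "generalized_weak_limit u x" "convex C" "closed C" "\<And>n. u n \<in> C"
  shows "x \<in> C"
proof (rule ccontr)
  assume "x \<notin> C"
  then obtain \<phi> :: "'a \<Rightarrow>\<^sub>L real" and d where d: "d > 0" "\<And>c. c \<in> C \<Longrightarrow> \<phi> x + d \<le> \<phi> c"
    using functional_separates_closed_convex[of C x] assms by blast
  then have "\<phi> x + d \<le> \<phi> x"
    using assms(4) by (intro generalized_weak_limit_ge[OF assms(1)]) simp
  with d show False by simp
qed

text \<open>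
  The functional \<open>p \<phi> = limsup (\<phi> (u n))\<close>, written below as the infimum of the eventual upper
  bounds, is sublinear and bounded on the dual space. A linear functional below it is an element of
  the bidual, hence evaluation at a point.
\<close>

lemma generalized_weak_limit_exists:
  fixes u :: "nat \<Rightarrow> 'a::real_normed_vector"
  assumes refl: "reflexive_space TYPE('a)" and B: "\<And>n. norm (u n) \<le> B"
  obtains x where "generalized_weak_limit u x"
proof -
  define S where "S \<phi> = {c. \<forall>\<^sub>F n in sequentially. blinfun_apply \<phi> (u n) \<le> c}"
    for \<phi> :: "'a \<Rightarrow>\<^sub>L real"
  have bound: "\<bar>\<phi> (u n)\<bar> \<le> B * norm \<phi>" for \<phi> :: "'a \<Rightarrow>\<^sub>L real" and n
  proof -
    have "\<bar>\<phi> (u n)\<bar> \<le> norm \<phi> * norm (u n)" using norm_blinfun[of \<phi> "u n"] by simp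
    also have "\<dots> \<le> norm \<phi> * B" by (intro mult_left_mono B norm_ge_zero)
    finally show ?thesis by (simp only: mult.commute)
  qed
  have up: "B * norm \<phi> \<in> S \<phi>" for \<phi>
    unfolding S_def using bound[of \<phi>] by (simp add: abs_le_iff)
  have ne: "S \<phi> \<noteq> {}" for \<phi> using up by blast
  have "- (B * norm \<phi>) \<le> c" if "c \<in> S \<phi>" for c \<phi>
  proof -
    obtain n where "\<phi> (u n) \<le> c"
      using \<open>c \<in> S \<phi>\<close> eventually_happens[of "\<lambda>n. \<phi> (u n) \<le> c" sequentially]
      unfolding S_def by auto
    with bound[of \<phi> n] show ?thesis by linarith
  qed
  then have bdd: "bdd_below (S \<phi>)" for \<phi> by (rule bdd_belowI)
  define p where "p \<phi> = Inf (S \<phi>)" for \<phi>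
  have lower: "p \<phi> \<le> c" if "c \<in> S \<phi>" for \<phi> c
    unfolding p_def by (rule cInf_lower[OF that bdd])
  have "sublinear p"
  proof (rule sublinearI)
    fix \<phi> \<psi>
    have 1: "p (\<phi> + \<psi>) \<le> c + d" if "c \<in> S \<phi>" "d \<in> S \<psi>" for c d
    proof (rule lower)
      show "c + d \<in> S (\<phi> + \<psi>)"
        using that unfolding S_def mem_Collect_eq
        by eventually_elim (simp add: blinfun.add_left)
    qed
    have "p (\<phi> + \<psi>) - c \<le> d" if "c \<in> S \<phi>" "d \<in> S \<psi>" for c d
      using 1[OF that] by simp
    then have 2: "p (\<phi> + \<psi>) - c \<le> p \<psi>" if "c \<in> S \<phi>" for c
      unfolding p_def[of \<psi>] using that by (intro cInf_greatest ne)
    have "p (\<phi> + \<psi>) - p \<psi> \<le> c" if "c \<in> S \<phi>" for c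
      using 2[OF that] by simp
    then have "p (\<phi> + \<psi>) - p \<psi> \<le> p \<phi>"
      unfolding p_def[of \<phi>] by (intro cInf_greatest ne)
    then show "p (\<phi> + \<psi>) \<le> p \<phi> + p \<psi>" by simp
  next
    fix t :: real and \<phi> assume t: "t > 0"
    have "p (t *\<^sub>R \<phi>) / t \<le> c" if "c \<in> S \<phi>" for c
    proof -
      have "t * c \<in> S (t *\<^sub>R \<phi>)"
        using that t unfolding S_def by (simp add: blinfun.scaleR_left)
      with lower t show ?thesis by (simp add: field_simps)
    qed
    then have "p (t *\<^sub>R \<phi>) / t \<le> p \<phi>"
      unfolding p_def[of \<phi>] by (intro cInf_greatest ne)
    then show "p (t *\<^sub>R \<phi>) \<le> t * p \<phi>" using t by (simp add: field_simps)
  qed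
  then obtain \<Phi> :: "('a \<Rightarrow>\<^sub>L real) \<Rightarrow>\<^sub>L real" where \<Phi>: "\<And>\<phi>. \<Phi> \<phi> \<le> p \<phi>"
    using blinfun_below_sublinear[of p B] lower[OF up] by blast
  obtain x where x: "\<And>\<phi>. \<Phi> \<phi> = blinfun_apply \<phi> x"
    using refl unfolding reflexive_space_def by blast
  have "\<phi> x \<le> c" if "\<forall>\<^sub>F n in sequentially. \<phi> (u n) \<le> c" for \<phi> :: "'a \<Rightarrow>\<^sub>L real" and c
    using \<Phi>[of \<phi>] x[of \<phi>] lower[of c \<phi>] that by (simp add: S_def)
  then show ?thesis using that by (auto simp: generalized_weak_limit_def)
qed

text \<open>
  The set \<open>D\<close> consists of the finite rational combinations of the \<open>u n\<close>; stage \<open>E n\<close> uses the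
  first \<open>n\<close> vectors, so that the real spans can be approximated one vector at a time.
\<close>

lemma countable_dense_in_span:
  fixes u :: "nat \<Rightarrow> 'a::real_normed_vector"
  obtains D where "countable D" "span (range u) \<subseteq> closure D"
proof -
  define E where "E = rec_nat {0} (\<lambda>n A. (\<lambda>(d, q). d + of_rat q *\<^sub>R u n) ` (A \<times> UNIV))"
  have E0: "E 0 = {0}" and ES: "\<And>n. E (Suc n) = (\<lambda>(d, q). d + of_rat q *\<^sub>R u n) ` (E n \<times> UNIV)"
    by (simp_all add: E_def)
  have cE: "countable (E n)" for n
    by (induction n) (auto simp: E0 ES)
  have sub: "span (u ` {..<n}) \<subseteq> closure (E n)" for n
  proof (induction n)
    case (Suc n)
    show ?case
    proof
      fix x assume "x \<in> span (u ` {..<Suc n})"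
      then obtain k where k: "x - k *\<^sub>R u n \<in> span (u ` {..<n})"
        by (auto simp: lessThan_Suc span_breakdown_eq)
      show "x \<in> closure (E (Suc n))"
        unfolding closure_approachable
      proof (intro allI impI)
        fix e :: real assume e: "e > 0"
        obtain d where d: "d \<in> E n" "dist d (x - k *\<^sub>R u n) < e / 2"
          using Suc k e by (meson closure_approachable half_gt_zero subsetD)
        \<comment> \<open>The summand 1 keeps the denominator positive when \<open>u n = 0\<close>.\<close>
        define \<eta> where "\<eta> = e / (2 * (norm (u n) + 1))"
        have \<eta>: "\<eta> > 0" using e by (simp add: \<eta>_def add_nonneg_pos)
        obtain q where q: "k < of_rat q" "of_rat q < k + \<eta>"
          using of_rat_dense[of k "k + \<eta>"] \<eta> by auto
        have "norm ((of_rat q - k) *\<^sub>R u n) \<le> \<eta> * (norm (u n) + 1)"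
          using q by (auto intro!: mult_mono)
        also have "\<dots> = e / 2"
          using norm_ge_zero[of "u n"] by (simp add: \<eta>_def field_simps add_nonneg_eq_0_iff)
        finally have "norm ((of_rat q - k) *\<^sub>R u n) \<le> e / 2" .
        moreover have "d + of_rat q *\<^sub>R u n - x = (d - (x - k *\<^sub>R u n)) + (of_rat q - k) *\<^sub>R u n"
          by (simp add: algebra_simps)
        then have "dist (d + of_rat q *\<^sub>R u n) x
            \<le> dist d (x - k *\<^sub>R u n) + norm ((of_rat q - k) *\<^sub>R u n)"
          unfolding dist_norm by (metis norm_triangle_ineq)
        ultimately have "dist (d + of_rat q *\<^sub>R u n) x < e"
          using d(2) by linarith
        moreover have "d + of_rat q *\<^sub>R u n \<in> E (Suc n)"
          using d(1) by (auto simp: ES)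
        ultimately show "\<exists>y\<in>E (Suc n). dist y x < e" by blast
      qed
    qed
  qed (simp add: E0)
  have "span (range u) \<subseteq> closure (\<Union>n. E n)"
  proof
    fix x assume "x \<in> span (range u)"
    then obtain T c where T: "finite T" "T \<subseteq> range u" "x = (\<Sum>a\<in>T. c a *\<^sub>R a)"
      unfolding span_explicit by blast
    have "x \<in> span T" unfolding T(3) by (intro span_sum span_scale span_base)
    obtain I where I: "finite I" "T = u ` I" using finite_subset_image[OF T(1,2)] by blast
    then obtain n where "I \<subseteq> {..<n}" using finite_nat_bounded by blast
    then have "x \<in> span (u ` {..<n})" using \<open>x \<in> span T\<close> I(2) span_mono[of T "u ` {..<n}"] by blast
    with sub[of n] show "x \<in> closure (\<Union>n. E n)"
      using closure_mono[of "E n" "\<Union>n. E n"] by blast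
  qed
  with cE that[of "\<Union>n. E n"] show ?thesis by simp
qed

text \<open>
  Norming functionals \<open>\<Psi> d\<close> for the points \<open>d\<close> of a countable dense set suffice: if all of them vanish at
  \<open>y\<close> and \<open>d\<close> is close to \<open>y\<close>, then \<open>\<parallel>d\<parallel> \<le> \<Psi> d (d - y) \<le> \<parallel>d - y\<parallel>\<close> is small, and so is \<open>\<parallel>y\<parallel>\<close>.
\<close>

lemma countable_separating_functionals:
  fixes u :: "nat \<Rightarrow> 'a::real_normed_vector"
  obtains \<psi> :: "nat \<Rightarrow> 'a \<Rightarrow>\<^sub>L real"
  where "\<And>k v. \<bar>\<psi> k v\<bar> \<le> norm v"
    and "\<And>y. y \<in> closure (span (range u)) \<Longrightarrow> (\<And>k. \<psi> k y = 0) \<Longrightarrow> y = 0"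
proof -
  obtain D where D: "countable D" "span (range u) \<subseteq> closure D"
    using countable_dense_in_span by blast
  have "D \<noteq> {}" using D(2) span_zero[of "range u"] by force
  have "\<exists>\<psi> :: 'a \<Rightarrow>\<^sub>L real. (\<forall>v. \<bar>\<psi> v\<bar> \<le> norm v) \<and> norm d \<le> \<psi> d" for d
    using functional_above_on_convex[of "{d}" "norm d"] by auto
  then obtain \<Psi> :: "'a \<Rightarrow> 'a \<Rightarrow>\<^sub>L real"
    where \<Psi>: "\<And>d v. \<bar>\<Psi> d v\<bar> \<le> norm v" "\<And>d. norm d \<le> \<Psi> d d" by metis
  have "y = 0" if y: "y \<in> closure (span (range u))" and 0: "\<And>k. \<Psi> (from_nat_into D k) y = 0" for y
  proof (rule ccontr)
    assume "y \<noteq> 0"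
    have "y \<in> closure D" using y closure_minimal[OF D(2)] by auto
    with \<open>y \<noteq> 0\<close> obtain d where d: "d \<in> D" "dist d y < norm y / 2"
      unfolding closure_approachable by (metis half_gt_zero zero_less_norm_iff)
    obtain k where "d = from_nat_into D k" using from_nat_into_surj[OF D(1) d(1)] by metis
    with 0 have "\<Psi> d y = 0" by simp
    then have "norm d \<le> \<Psi> d (d - y)" using \<Psi>(2)[of d] by (simp add: blinfun.diff_right)
    also have "\<dots> \<le> norm (d - y)" using \<Psi>(1)[of d "d - y"] by simp
    finally show False using d(2) norm_triangle_sub[of y d] by (simp add: dist_norm norm_minus_commute)
  qed
  with \<Psi>(1) that[of "\<lambda>k. \<Psi> (from_nat_into D k)"] show ?thesis by blast
qed

text \<open>
  The rows are bounded, so the sequence of columns lies in a compact product of intervals, and countable products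
  of intervals are metrizable.
\<close>

lemma diagonal_subsequence:
  fixes a :: "nat \<Rightarrow> nat \<Rightarrow> real"
  assumes "\<And>k n. \<bar>a k n\<bar> \<le> B"
  obtains r :: "nat \<Rightarrow> nat" and l where "strict_mono r" "\<And>k. (\<lambda>n. a k (r n)) \<longlonglongrightarrow> l k"
proof -
  have "compact (PiE (UNIV :: nat set) (\<lambda>_. {- B..B}))"
    using compactin_PiE[of "\<lambda>_. euclidean" "UNIV :: nat set" "\<lambda>_. {- B..B}"]
    by (simp add: euclidean_product_topology)
  then have "seq_compact (PiE (UNIV :: nat set) (\<lambda>_. {- B..B}))"
    by (rule compact_imp_seq_compact)
  moreover have "(\<lambda>k. a k n) \<in> PiE UNIV (\<lambda>_. {- B..B})" for n
    using assms by (auto simp: PiE_iff abs_le_iff minus_le_iff)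
  ultimately obtain l r where r: "strict_mono r" "((\<lambda>n k. a k n) \<circ> r) \<longlonglongrightarrow> l"
    unfolding seq_compact_def by meson
  have "(\<lambda>n. a k (r n)) \<longlonglongrightarrow> l k" for k
    using continuous_on_tendsto_compose[OF continuous_on_product_coordinates[of k] r(2)]
    by (simp add: o_def)
  with r(1) that show ?thesis by blast
qed

lemma subspace_closure:
  fixes S :: "'a::real_normed_vector set"
  assumes "subspace S"
  shows "subspace (closure S)"
proof (rule subspaceI)
  show "0 \<in> closure S"
    using subspace_0[OF assms] closure_subset by blast
next
  fix x y assume "x \<in> closure S" "y \<in> closure S"
  then obtain a b where "\<And>n. a n \<in> S" "a \<longlonglongrightarrow> x" "\<And>n. b n \<in> S" "b \<longlonglongrightarrow> y"
    unfolding closure_sequential by blast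
  then have "\<And>n. a n + b n \<in> S" "(\<lambda>n. a n + b n) \<longlonglongrightarrow> x + y"
    using subspace_add[OF assms] tendsto_add by blast+
  then show "x + y \<in> closure S"
    unfolding closure_sequential by (intro exI[of _ "\<lambda>n. a n + b n"]) simp
next
  fix c x assume "x \<in> closure S"
  then obtain a where "\<And>n. a n \<in> S" "a \<longlonglongrightarrow> x"
    unfolding closure_sequential by blast
  then have "\<And>n. c *\<^sub>R a n \<in> S" "(\<lambda>n. c *\<^sub>R a n) \<longlonglongrightarrow> c *\<^sub>R x"
    using subspace_scale[OF assms] by (auto intro: tendsto_intros)
  then show "c *\<^sub>R x \<in> closure S"
    unfolding closure_sequential by (intro exI[of _ "\<lambda>n. c *\<^sub>R a n"]) simp
qed

text \<open>
  Along the diagonal subsequence \<open>u \<circ> r\<close> the separating functionals converge, so they have the same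
  values at the generalized weak limits of all its further subsequences. These limits lie in the
  closed span of \<open>u\<close> and hence are one point \<open>x\<close>. If some functional did not converge to its value
  at \<open>x\<close>, a further subsequence would stay away from that value, which its generalized weak limit \<open>x\<close> forbids.
\<close>

theorem reflexive_weakly_convergent_subsequence:
  fixes u :: "nat \<Rightarrow> 'a::real_normed_vector"
  assumes refl: "reflexive_space TYPE('a)" and B: "\<And>n. norm (u n) \<le> B"
  obtains r x where "strict_mono r" "weakly_converges (u \<circ> r) x"
proof -
  define Y where "Y = closure (span (range u))"
  have Y: "convex Y" "closed Y" "subspace Y"
    by (simp_all add: Y_def subspace_closure subspace_imp_convex)
  have uY: "u n \<in> Y" for n
    unfolding Y_def by (rule subsetD[OF closure_subset]) (simp add: span_base)
  obtain \<psi> :: "nat \<Rightarrow> 'a \<Rightarrow>\<^sub>L real" where \<psi>: "\<And>k v. \<bar>\<psi> k v\<bar> \<le> norm v"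
      "\<And>y. y \<in> Y \<Longrightarrow> (\<And>k. \<psi> k y = 0) \<Longrightarrow> y = 0"
    unfolding Y_def using countable_separating_functionals[of u] by blast
  obtain r l where r: "strict_mono r" "\<And>k. (\<lambda>n. \<psi> k (u (r n))) \<longlonglongrightarrow> l k"
    using diagonal_subsequence[of "\<lambda>k n. \<psi> k (u n)" B] order_trans[OF \<psi>(1) B] by blast
  have sub: "\<exists>x\<in>Y. generalized_weak_limit (u \<circ> r \<circ> s) x \<and> (\<forall>k. \<psi> k x = l k)"
    if "strict_mono s" for s
  proof -
    obtain x where x: "generalized_weak_limit (u \<circ> r \<circ> s) x"
      using generalized_weak_limit_exists[OF refl, of "u \<circ> r \<circ> s" B] B by auto
    have "\<psi> k x = l k" for k
      using LIMSEQ_subseq_LIMSEQ[OF r(2)[of k] that]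
      by (intro generalized_weak_limit_eq[OF x]) (simp add: o_def)
    moreover have "x \<in> Y"
      using uY Y by (intro generalized_weak_limit_in_closed_convex[OF x]) auto
    ultimately show ?thesis using x by blast
  qed
  obtain x where x: "x \<in> Y" "\<And>k. \<psi> k x = l k"
    using sub[of id] by (auto simp: strict_mono_def)
  have unique: "generalized_weak_limit (u \<circ> r \<circ> s) x" if s: "strict_mono s" for s
  proof -
    obtain y where y: "y \<in> Y" "generalized_weak_limit (u \<circ> r \<circ> s) y" "\<And>k. \<psi> k y = l k"
      using sub[OF s] by blast
    have "y - x = 0"
      using x y subspace_diff[OF Y(3)] by (intro \<psi>(2)) (auto simp: blinfun.diff_right)
    with y show ?thesis by simp
  qed
  have upper: "\<forall>\<^sub>F n in sequentially. \<phi> (u (r n)) < c" if c: "\<phi> x < c"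
    for \<phi> :: "'a \<Rightarrow>\<^sub>L real" and c
  proof (rule ccontr)
    assume "\<not> ?thesis"
    then have "\<exists>\<^sub>F n in sequentially. \<not> \<phi> (u (r n)) < c"
      unfolding not_eventually .
    then have "infinite {n. \<not> \<phi> (u (r n)) < c}"
      unfolding cofinite_eq_sequentially[symmetric] frequently_cofinite .
    then obtain s :: "nat \<Rightarrow> nat" where s: "strict_mono s" "\<And>n. s n \<in> {n. \<not> \<phi> (u (r n)) < c}"
      using infinite_enumerate by blast
    have "c \<le> \<phi> x"
      using s(2) by (intro generalized_weak_limit_ge[OF unique[OF s(1)]]) (simp add: not_less)
    with c show False by simp
  qed
  have "(\<lambda>n. \<phi> ((u \<circ> r) n)) \<longlonglongrightarrow> \<phi> x" for \<phi> :: "'a \<Rightarrow>\<^sub>L real"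
  proof (rule order_tendstoI)
    fix c assume "\<phi> x < c"
    then show "\<forall>\<^sub>F n in sequentially. \<phi> ((u \<circ> r) n) < c" using upper by simp
  next
    fix c assume "c < \<phi> x"
    then show "\<forall>\<^sub>F n in sequentially. c < \<phi> ((u \<circ> r) n)"
      using upper[of "- \<phi>" "- c"] by (simp add: blinfun.minus_left)
  qed
  then show ?thesis using that r(1) by (auto simp: weakly_converges_def)
qed

lemma weakly_converges_in_closed_convex:
  assumes "weakly_converges u x" "convex C" "closed C" "\<And>n. u n \<in> C"
  shows "x \<in> C"
proof (rule generalized_weak_limit_in_closed_convex)
  show "generalized_weak_limit u x"
    using assms(1) unfolding generalized_weak_limit_def weakly_converges_def
    by (auto intro: tendsto_upperbound)
qed (use assms in auto)

section \<open>Averaged iterations\<close>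

lemma limsup_norm_le_zero_imp_tendsto:
  fixes z :: "nat \<Rightarrow> 'a::real_normed_vector"
  assumes "limsup (\<lambda>n. ereal (norm (z n))) \<le> 0"
  shows "z \<longlonglongrightarrow> 0"
proof (rule LIMSEQ_I)
  fix e :: real assume "e > 0"
  then have "0 < ereal e" by simp
  with assms have "\<forall>\<^sub>F n in sequentially. ereal (norm (z n)) < ereal e"
    unfolding Limsup_le_iff by blast
  then show "\<exists>N. \<forall>n\<ge>N. norm (z n - 0) < e"
    by (simp add: eventually_sequentially)
qed

text \<open>
  Induction on \<open>i\<close>, moving the index of \<open>x\<close> back by one. From
  \<open>y (m + i + 1) - x (m + 1) = (1 - l) (y (m + i + 1) - x m) + l (y (m + i + 1) - y m)\<close>
  a lower bound for the left-hand side and the upper bound \<open>(i + 1) (l r + k)\<close> for \<open>\<parallel>y (m + i + 1) - y m\<parallel>\<close>, where \<open>k\<close>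
  is a small error, bound \<open>\<parallel>y (m + i + 1) - x m\<parallel>\<close> from below. The constants fit because
  \<open>1 + i l - (i + 1) l\<^sup>2 = (1 - l) (1 + (i + 1) l)\<close>.
\<close>

lemma averaged_iteration_growth:
  fixes x y :: "nat \<Rightarrow> 'a::real_normed_vector"
  assumes l: "0 < l" "l < 1"
    and x: "\<And>n. x (Suc n) = (1 - l) *\<^sub>R x n + l *\<^sub>R y n"
    and step: "\<And>e. e > 0 \<Longrightarrow> \<exists>N. \<forall>n\<ge>N. norm (y (Suc n) - y n) \<le> l * r + e"
    and often: "\<And>e N. e > 0 \<Longrightarrow> \<exists>n\<ge>N. r - e \<le> norm (y n - x n)"
    and e: "e > 0"
  shows "\<exists>n\<ge>N. (1 + real i * l) * r - e \<le> norm (y (n + i) - x n)"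
  using e
proof (induction i arbitrary: e N)
  case 0
  then show ?case using often by simp
next
  case (Suc i)
  \<comment> \<open>Half of the error \<open>(1 - l) e\<close> is for the induction hypothesis, half for the \<open>i + 1\<close> steps of \<open>y\<close>.\<close>
  define h where "h = (1 - l) * e / 2"
  define k where "k = h / (l * real (Suc i))"
  have h2: "2 * h = (1 - l) * e" by (simp add: h_def)
  have h: "h > 0" and k: "k > 0" using Suc.prems l by (simp_all add: h_def k_def)
  have lk: "l * (real (Suc i) * k) = h" using l by (simp add: k_def)
  obtain N' where N': "\<And>n. n \<ge> N' \<Longrightarrow> norm (y (Suc n) - y n) \<le> l * r + k"
    using step[OF k] by blast
  \<comment> \<open>\<open>n\<close> is taken above the thresholds by one, so that its predecessor \<open>m\<close> still meets them.\<close>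
  obtain n where n: "n \<ge> Suc (max N N')" "(1 + real i * l) * r - h \<le> norm (y (n + i) - x n)"
    using Suc.IH[OF h] by blast
  then obtain m where m: "n = Suc m" "m \<ge> N" "m \<ge> N'" by (cases n) auto
  have tele: "norm (y (m + j) - y m) \<le> real j * (l * r + k)" for j
  proof (induction j)
    case (Suc j)
    have "norm (y (m + Suc j) - y m) \<le> norm (y (Suc (m + j)) - y (m + j)) + norm (y (m + j) - y m)"
      using norm_triangle_ineq[of "y (Suc (m + j)) - y (m + j)" "y (m + j) - y m"] by simp
    also have "\<dots> \<le> (l * r + k) + real j * (l * r + k)"
      using N'[of "m + j"] m Suc by (intro add_mono) auto
    finally show ?case by (simp add: algebra_simps)
  qed simp
  define Z where "Z = norm (y (m + Suc i) - x m)"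
  have "y (n + i) - x n = (1 - l) *\<^sub>R (y (m + Suc i) - x m) + l *\<^sub>R (y (m + Suc i) - y m)"
    by (simp add: m x algebra_simps)
  then have "norm (y (n + i) - x n) \<le> (1 - l) * Z + l * norm (y (m + Suc i) - y m)"
    using norm_triangle_ineq[of "(1 - l) *\<^sub>R (y (m + Suc i) - x m)" "l *\<^sub>R (y (m + Suc i) - y m)"] l
    by (simp add: Z_def)
  also have "\<dots> \<le> (1 - l) * Z + l * (real (Suc i) * (l * r + k))"
    using tele[of "Suc i"] l by (intro add_mono mult_left_mono) auto
  also have "l * (real (Suc i) * (l * r + k)) = l * real (Suc i) * (l * r) + h"
    unfolding lk[symmetric] by (simp only: distrib_left mult.assoc)
  finally have "(1 + real i * l) * r - l * real (Suc i) * (l * r) - 2 * h \<le> (1 - l) * Z"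
    using n(2) by linarith
  also have "(1 + real i * l) * r - l * real (Suc i) * (l * r) - 2 * h
      = (1 - l) * ((1 + real (Suc i) * l) * r - e)"
    unfolding h2 by (simp add: algebra_simps)
  finally have "(1 + real (Suc i) * l) * r - e \<le> Z" using l by simp
  then show ?case using m unfolding Z_def by blast
qed

text \<open>
  The classical hypothesis compares \<open>\<parallel>y (n + 1) - y n\<parallel>\<close> with \<open>\<parallel>x (n + 1) - x n\<parallel>\<close> for each \<open>n\<close>;
  a comparison of the two limsups is enough. With \<open>s\<close> the limsup of \<open>\<parallel>x (n + 1) - x n\<parallel>\<close>, the quantities
  \<open>\<parallel>y n - x n\<parallel>\<close> have limsup \<open>s / l\<close>, and the linear growth just established contradicts the bound \<open>D\<close> unless \<open>s\<close> is 0.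
\<close>

theorem averaged_iteration_asymptotically_regular:
  fixes x y :: "nat \<Rightarrow> 'a::real_normed_vector"
  assumes l: "0 < l" "l < 1"
    and x: "\<And>n. x (Suc n) = (1 - l) *\<^sub>R x n + l *\<^sub>R y n"
    and D: "\<And>m n. norm (y m - x n) \<le> D"
    and le: "limsup (\<lambda>n. ereal (norm (y (Suc n) - y n))) \<le> limsup (\<lambda>n. ereal (norm (x (Suc n) - x n)))"
  shows "(\<lambda>n. y n - x n) \<longlonglongrightarrow> 0"
proof -
  have dx: "x (Suc n) - x n = l *\<^sub>R (y n - x n)" for n
    by (simp add: x algebra_simps)
  have norm_dx: "norm (x (Suc n) - x n) = l * norm (y n - x n)" for n
    using l by (simp add: dx)
  define L where "L = limsup (\<lambda>n. ereal (norm (x (Suc n) - x n)))"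
  have "L \<le> ereal (l * D)"
    unfolding L_def using D l by (intro Limsup_bounded always_eventually) (simp add: norm_dx)
  moreover have "0 \<le> L"
    unfolding L_def by (rule le_Limsup) auto
  ultimately obtain s where s: "L = ereal s" by (cases L) auto
  have above: "\<exists>N. \<forall>n\<ge>N. z n \<le> s + e" if "limsup (\<lambda>n. ereal (z n)) \<le> L" "e > 0" for z e
  proof -
    have "\<forall>\<^sub>F n in sequentially. ereal (z n) < ereal (s + e)"
      using that unfolding s Limsup_le_iff by (metis ereal_less(1) less_add_same_cancel1 less_ereal.simps(1))
    then show ?thesis unfolding eventually_sequentially by (auto intro: less_imp_le)
  qed
  have often: "\<exists>n\<ge>N. s / l - e \<le> norm (y n - x n)" if "e > 0" for e N
  proof (rule ccontr)
    assume "\<not> ?thesis"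
    then have "norm (y n - x n) \<le> s / l - e" if "n \<ge> N" for n using that by force
    then have "norm (x (Suc n) - x n) \<le> l * (s / l - e)" if "n \<ge> N" for n
      unfolding norm_dx using that l by (intro mult_left_mono) auto
    then have "\<forall>\<^sub>F n in sequentially. ereal (norm (x (Suc n) - x n)) \<le> ereal (s - l * e)"
      using l by (auto simp: eventually_sequentially algebra_simps)
    then have "L \<le> ereal (s - l * e)" unfolding L_def by (rule Limsup_bounded)
    with s mult_pos_pos[OF l(1) \<open>e > 0\<close>] show False by simp
  qed
  have "s \<le> 0"
  proof (rule ccontr)
    assume "\<not> s \<le> 0"
    then obtain i where i: "D + 1 < real i * s" using reals_Archimedean3 by (metis not_le)
    have "\<exists>N. \<forall>n\<ge>N. norm (y (Suc n) - y n) \<le> l * (s / l) + e" if "e > 0" for e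
      using above[OF le[folded L_def] that] l by simp
    then obtain n where "(1 + real i * l) * (s / l) - 1 \<le> norm (y (n + i) - x n)"
      using averaged_iteration_growth[OF l x _ often, of 1 0 i] by auto
    moreover have "(1 + real i * l) * (s / l) = s / l + real i * s" using l by (simp add: field_simps)
    moreover have "s / l > 0" using l \<open>\<not> s \<le> 0\<close> by simp
    ultimately show False using i D[of "n + i" n] by linarith
  qed
  then have "(\<lambda>n. x (Suc n) - x n) \<longlonglongrightarrow> 0"
    using s by (intro limsup_norm_le_zero_imp_tendsto) (simp add: L_def)
  then have "(\<lambda>n. (1 / l) *\<^sub>R (x (Suc n) - x n)) \<longlonglongrightarrow> 0"
    using tendsto_scaleR[OF tendsto_const] by fastforce
  moreover have "y n - x n = (1 / l) *\<^sub>R (x (Suc n) - x n)" for n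
    using l by (simp add: dx)
  ultimately show ?thesis by simp
qed

section \<open>Fixed points\<close>

text \<open>
  Replacing \<open>v n\<close> by \<open>f (v n)\<close> costs a null sequence, so \<open>f x\<close> is asymptotically as close to \<open>v\<close>
  as \<open>x\<close> is; Opial's condition makes \<open>x\<close> the only such point.
\<close>

theorem opial_demiclosed:
  fixes f :: "'a::real_normed_vector \<Rightarrow> 'a"
  assumes opial: "opial_space TYPE('a)" and ne: "weakly_seq_nonexpansive_at M f x"
    and v: "\<And>n. v n \<in> M" "weakly_converges v x" and fv: "(\<lambda>n. f (v n) - v n) \<longlonglongrightarrow> 0"
  shows "f x = x"
proof (rule ccontr)
  assume "f x \<noteq> x"
  have "liminf (\<lambda>n. ereal (norm (v n - f x)))
      \<le> liminf (\<lambda>n. ereal (norm (f (v n) - v n)) + ereal (norm (f (v n) - f x)))"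
  proof (intro Liminf_mono always_eventually allI)
    fix n
    show "ereal (norm (v n - f x)) \<le> ereal (norm (f (v n) - v n)) + ereal (norm (f (v n) - f x))"
      using norm_triangle_ineq[of "v n - f (v n)" "f (v n) - f x"] by (simp add: norm_minus_commute)
  qed
  also have "\<dots> = 0 + liminf (\<lambda>n. ereal (norm (f (v n) - f x)))"
    using tendsto_norm_zero[OF fv] by (intro ereal_liminf_lim_add) (simp_all add: zero_ereal_def)
  also have "\<dots> \<le> liminf (\<lambda>n. ereal (norm (v n - x)))"
    using ne v unfolding weakly_seq_nonexpansive_at_def by simp
  finally show False
    using opial v(2) \<open>f x \<noteq> x\<close> unfolding opial_space_def by (meson not_le)
qed

text \<open>
  The weight of \<open>u n\<close> in the averaged iteration is the constant \<open>\<delta>\<close> of property \<open>\<flat>\<close>: this is what keeps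
  \<open>\<parallel>u (n + 1) - f (u n)\<parallel>\<close> below \<open>\<delta>\<close> times the diameter, so that the property can be used contrapositively.
\<close>

theorem property_flat_approximate_fixed_points:
  fixes f :: "'a::real_normed_vector \<Rightarrow> 'a"
  assumes "M \<noteq> {}" "bounded M" "convex M" and f: "f \<in> M \<rightarrow> M" and flat: "property_flat M f"
  obtains u where "\<And>n. u n \<in> M" "(\<lambda>n. f (u n) - u n) \<longlonglongrightarrow> 0"
proof -
  obtain \<delta> where \<delta>: "0 < \<delta>" "\<delta> < 1" and
    flat: "\<And>u :: nat \<Rightarrow> 'a. (\<And>n. u n \<in> M) \<Longrightarrow>
           0 < limsup (\<lambda>n. ereal (norm (u (Suc n) - u n))) \<Longrightarrow>
           limsup (\<lambda>n. ereal (norm (u (Suc n) - u n)))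
             < limsup (\<lambda>n. ereal (norm (f (u (Suc n)) - f (u n)))) \<Longrightarrow>
           limsup (\<lambda>n. ereal (norm (u (Suc n) - f (u n)))) > ereal (\<delta> * diameter M)"
    using flat unfolding property_flat_def by blast
  obtain a where a: "a \<in> M" using assms by blast
  define u where "u n = ((\<lambda>v. \<delta> *\<^sub>R v + (1 - \<delta>) *\<^sub>R f v) ^^ n) a" for n
  have uS: "u (Suc n) = (1 - (1 - \<delta>)) *\<^sub>R u n + (1 - \<delta>) *\<^sub>R f (u n)" for n
    by (simp add: u_def)
  have uM: "u n \<in> M" for n
  proof (induction n)
    case (Suc n)
    then show ?case unfolding uS using f \<delta> by (intro convexD[OF \<open>convex M\<close>]) auto
  qed (simp add: u_def a)
  have fuM: "f (u n) \<in> M" for n using uM f by blast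
  have diam: "norm (v - w) \<le> diameter M" if "v \<in> M" "w \<in> M" for v w
    using diameter_bounded_bound[OF \<open>bounded M\<close> that] by (simp add: dist_norm)
  have "norm (u (Suc n) - f (u n)) \<le> \<delta> * diameter M" for n
  proof -
    have "u (Suc n) - f (u n) = \<delta> *\<^sub>R (u n - f (u n))" unfolding uS by (simp add: algebra_simps)
    then show ?thesis using diam[OF uM[of n] fuM[of n]] \<delta> by (simp add: mult_left_mono)
  qed
  then have "\<not> limsup (\<lambda>n. ereal (norm (u (Suc n) - f (u n)))) > ereal (\<delta> * diameter M)"
    by (simp add: not_less Limsup_bounded)
  with flat[OF uM] have "limsup (\<lambda>n. ereal (norm (u (Suc n) - u n))) \<le> 0 \<or>
      limsup (\<lambda>n. ereal (norm (f (u (Suc n)) - f (u n)))) \<le> limsup (\<lambda>n. ereal (norm (u (Suc n) - u n)))"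
    by (meson not_less)
  then have "(\<lambda>n. f (u n) - u n) \<longlonglongrightarrow> 0"
  proof
    assume "limsup (\<lambda>n. ereal (norm (f (u (Suc n)) - f (u n)))) \<le> limsup (\<lambda>n. ereal (norm (u (Suc n) - u n)))"
    then show ?thesis
      using diam fuM uM \<delta> by (intro averaged_iteration_asymptotically_regular[of "1 - \<delta>" u _ "diameter M"] uS) auto
  next
    assume "limsup (\<lambda>n. ereal (norm (u (Suc n) - u n))) \<le> 0"
    then have "(\<lambda>n. u (Suc n) - u n) \<longlonglongrightarrow> 0"
      by (rule limsup_norm_le_zero_imp_tendsto)
    moreover have "f (u n) - u n = (1 / (1 - \<delta>)) *\<^sub>R (u (Suc n) - u n)" for n
    proof -
      have "u (Suc n) - u n = (1 - \<delta>) *\<^sub>R (f (u n) - u n)" unfolding uS by (simp add: algebra_simps)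
      then show ?thesis using \<delta> by simp
    qed
    ultimately show ?thesis
      using tendsto_scaleR[OF tendsto_const, of "\<lambda>n. u (Suc n) - u n" 0 _ "1 / (1 - \<delta>)"] by simp
  qed
  with uM that show ?thesis by blast
qed

theorem theorem2p2:
  fixes M :: "'a::banach set" and f :: "'a \<Rightarrow> 'a"
  assumes "reflexive_space TYPE('a)"
    and "opial_space TYPE('a)"
    and "M \<noteq> {}" and "bounded M" and "closed M" and "convex M"
    and "diameter M > 0"
    and "f \<in> M \<rightarrow> M"
    and "weakly_seq_nonexpansive_on M f"
    and "property_flat M f"
  shows "\<exists>x\<in>M. f x = x"
proof -
  obtain u where u: "\<And>n. u n \<in> M" "(\<lambda>n. f (u n) - u n) \<longlonglongrightarrow> 0"
    using property_flat_approximate_fixed_points assms by blast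
  obtain B where "\<And>n. norm (u n) \<le> B"
    using u(1) \<open>bounded M\<close> unfolding bounded_iff by blast
  then obtain r x where r: "strict_mono r" "weakly_converges (u \<circ> r) x"
    using reflexive_weakly_convergent_subsequence assms(1) by blast
  have "x \<in> M"
    using r(2) assms u(1) by (intro weakly_converges_in_closed_convex[of "u \<circ> r" x M]) auto
  moreover have "f x = x"
  proof (rule opial_demiclosed[of M f x "u \<circ> r"])
    show "weakly_seq_nonexpansive_at M f x"
      using assms(9) \<open>x \<in> M\<close> by (simp add: weakly_seq_nonexpansive_on_def)
    show "(\<lambda>n. f ((u \<circ> r) n) - (u \<circ> r) n) \<longlonglongrightarrow> 0"
      using LIMSEQ_subseq_LIMSEQ[OF u(2) r(1)] by (simp add: o_def)
  qed (use assms u r in auto)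
  ultimately show ?thesis by blast
qed

end
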